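(* Let $R$ be a normed division ring that respects the rationals, let $n\ge 0$ be an integer, and let $G$ be a group that is $(n+1)$-dimensional admissible over $R$. Let $f_n\colon \mathbb{R}_{\ge 0}\to\mathbb{R}_{\ge 0}\cup\{\infty\}$ be the homological $n$-isoperimetric function of $G$ with respect to $R$. Then $f_n$ takes only finite values if and only if $f_n$ is bounded by a linear function.
   Context: All modules are left modules; $G$ is a discrete group and $RG$ its group ring. Normed rings. A normed ring is a (unital, associative) ring $R$ with a norm $|\cdot|\colon R\to\mathbb{R}_{\ge 0}$, i.e. $|a|=0$ iff $a=0$, $|a+b|\le |a|+|b|$, $|-a|=|a|$, $|ab|\le |a||b|$. It respects the rationals if $\mathbb{Q}$ is a subring of $R$ and $|qr|=|q||r|$ for all $q\in\mathbb{Q}$, $r\in R$, where $|q|$ on the right denotes the usual absolute value of the rational number $q$. $\ell^1$-norms. On a free $R$-module with fixed basis $\Lambda$ the $\ell^1$-norm is $\left|\sum_{x\in\Lambda}a_x x\right|=\sum_{x\in\Lambda}|a_x|$. A free $RG$-module with fixed $RG$-basis $\Lambda$ is regarded as a free $R$-module with basis $\Lambda\times G$ and given the corresponding $\ell^1$-norm. For a $G$-set $S$, the permutation $RG$-module $R[S]$ is the free $R$-module on $S$ with $G$-action extending $R$-linearly the action on $S$; its standard $\ell^1$-norm is the one given by the $R$-basis $S$. It is a proper permutation module if the $G$-stabilizer of each $s\in S$ is finite. Filling norms. If $\pi\colon F\to M$ is a surjective homomorphism of $RG$-modules, where $F$ carries an $\ell^1$-norm $|\cdot|$, the filling norm on $M$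 is $\|m\|=\inf\{|x| : x\in F,\ \pi(x)=m\}$. Isoperimetric function. A projective resolution $(C_k,\partial_k)$ of the trivial $RG$-module $R$ is $n$-admissible if $C_n$ and $C_{n+1}$ are finitely generated free $RG$-modules equipped with fixed free bases. Let $\|\cdot\|$ be the filling norm on $\operatorname{Im}(\partial_{n+1})\subseteq C_n$ induced by $\partial_{n+1}\colon C_{n+1}\twoheadrightarrow \operatorname{Im}(\partial_{n+1})$. The $n$-isoperimetric function of $(C_k,\partial_k)$ is $$f_n(l)=\sup\{\|b\| : b\in \operatorname{Im}(\partial_{n+1}),\ |b|\le l\}\in\mathbb{R}_{\ge 0}\cup\{\infty\},\qquad l\in \mathbb{R}_{\ge 0}.$$ The homological $n$-isoperimetric function of $G$ with respect to $R$ is the $n$-isoperimetric function of an $n$-admissible projective resolution of the trivial $RG$-module $R$; the properties considered in the claim do not depend on the chosen resolution. $f_n$ takes only finite values if $f_n(l)<\infty$ for every $l\in\mathbb{R}_{\ge 0}$. A function $f\colon\mathbb{R}_{\ge 0}\to\mathbb{R}_{\ge 0}\cup\{\infty\}$ is bounded by a linear function if there is $C\in\mathbb{R}$ with $f(l)\le Cl+C$ for every $l\in\mathbb{R}_{\ge 0}$. Admissible groups. $G$ is $(n+1)$-dimensional admissible over $R$ if there exists a projective resolution $(C_k,\partial_k)$ of the trivial $RG$-module $R$ such that $C_n$ and $C_{n+1}$ are finitely generated proper permutation $RG$-modules endowed with standard $\ell^1$-norms and $\partial_{n+1}\colon C_{n+1}\to C_n$ is injective. *)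

theory Defs
  imports "HOL-Analysis.Analysis" "HOL-Library.Poly_Mapping"
begin

section \<open>Normed rings\<close>

definition ring_norm :: "('r::ring_1 \<Rightarrow> real) \<Rightarrow> bool" where
  "ring_norm nrm \<longleftrightarrow>
     (\<forall>a. 0 \<le> nrm a) \<and>
     (\<forall>a. nrm a = 0 \<longleftrightarrow> a = 0) \<and>
     (\<forall>a b. nrm (a + b) \<le> nrm a + nrm b) \<and>
     (\<forall>a. nrm (- a) = nrm a) \<and>
     (\<forall>a b. nrm (a * b) \<le> nrm a * nrm b)"

text \<open>A division ring contains the rationals as a subring iff it has characteristic 0. The constant
  \<open>of_rat\<close> is only available for commutative fields, so rationals are written as
  fractions of integers.\<close>

definition respects_rationals :: "('r::{division_ring, ring_char_0} \<Rightarrow> real) \<Rightarrow> bool" where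
  "respects_rationals nrm \<longleftrightarrow>
     (\<forall>(p::int) (q::int) r. q \<noteq> 0 \<longrightarrow>
        nrm (of_int p / of_int q * r) = \<bar>real_of_int p / real_of_int q\<bar> * nrm r)"


section \<open>Left modules over a not necessarily commutative ring\<close>

text \<open>The library's locale \<open>module\<close> requires a commutative ring of scalars. A single module is a
  submodule \<open>M\<close> of an ambient module \<open>(sc, UNIV)\<close>; a sequence of modules is a
  sequence of submodules of one ambient module. This is no restriction, because the ambient module
  can be taken to be the direct sum of the sequence.\<close>

locale left_module =
  fixes sc :: "'a::ring_1 \<Rightarrow> 'm::ab_group_add \<Rightarrow> 'm"
  assumes sc_add_right: "sc a (x + y) = sc a x + sc a y"
    and sc_add_left: "sc (a + b) x = sc a x + sc b x"
    and sc_sc: "sc a (sc b x) = sc (a * b) x"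
    and sc_one: "sc 1 x = x"

definition submodule :: "('a::ring_1 \<Rightarrow> 'm::ab_group_add \<Rightarrow> 'm) \<Rightarrow> 'm set \<Rightarrow> bool" where
  "submodule sc M \<longleftrightarrow>
     0 \<in> M \<and> (\<forall>x\<in>M. \<forall>y\<in>M. x + y \<in> M) \<and> (\<forall>a. \<forall>x\<in>M. sc a x \<in> M)"

definition module_hom_on ::
  "('a::ring_1 \<Rightarrow> 'm::ab_group_add \<Rightarrow> 'm) \<Rightarrow> 'm set \<Rightarrow>
   ('a \<Rightarrow> 'k::ab_group_add \<Rightarrow> 'k) \<Rightarrow> 'k set \<Rightarrow> ('m \<Rightarrow> 'k) \<Rightarrow> bool" where
  "module_hom_on sc M sc' N f \<longleftrightarrow>
     f ` M \<subseteq> N \<and>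
     (\<forall>x\<in>M. \<forall>y\<in>M. f (x + y) = f x + f y) \<and>
     (\<forall>a. \<forall>x\<in>M. f (sc a x) = sc' a (f x))"

definition lincomb ::
  "('a::ring_1 \<Rightarrow> 'm::ab_group_add \<Rightarrow> 'm) \<Rightarrow> ('m \<Rightarrow>\<^sub>0 'a) \<Rightarrow> 'm" where
  "lincomb sc c = (\<Sum>x\<in>Poly_Mapping.keys c. sc (Poly_Mapping.lookup c x) x)"

definition combs :: "'x set \<Rightarrow> ('x \<Rightarrow>\<^sub>0 'a::zero) set" where
  "combs B = {c. Poly_Mapping.keys c \<subseteq> B}"

definition module_basis ::
  "('a::ring_1 \<Rightarrow> 'm::ab_group_add \<Rightarrow> 'm) \<Rightarrow> 'm set \<Rightarrow> 'm set \<Rightarrow> bool" where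
  "module_basis sc M B \<longleftrightarrow> B \<subseteq> M \<and> bij_betw (lincomb sc) (combs B) M"

definition coords ::
  "('a::ring_1 \<Rightarrow> 'm::ab_group_add \<Rightarrow> 'm) \<Rightarrow> 'm set \<Rightarrow> 'm \<Rightarrow> ('m \<Rightarrow>\<^sub>0 'a)" where
  "coords sc B = the_inv_into (combs B) (lincomb sc)"

definition fin_gen ::
  "('a::ring_1 \<Rightarrow> 'm::ab_group_add \<Rightarrow> 'm) \<Rightarrow> 'm set \<Rightarrow> bool" where
  "fin_gen sc M \<longleftrightarrow> (\<exists>X. finite X \<and> X \<subseteq> M \<and> M = lincomb sc ` combs X)"

text \<open>\<open>combs X\<close> with \<open>free_scale\<close> is the free module on the set \<open>X\<close>.\<close>

definition free_scale :: "'a::ring_1 \<Rightarrow> ('x \<Rightarrow>\<^sub>0 'a) \<Rightarrow> ('x \<Rightarrow>\<^sub>0 'a)" where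
  "free_scale a c = Poly_Mapping.map (\<lambda>b. a * b) c"

text \<open>\<open>P\<close> is a direct summand of a free module, up to isomorphism. The set \<open>X\<close> of free generators
  may be taken inside the type of \<open>P\<close>, since \<open>X = P\<close> always suffices. Two lemmas below relate this
  to the lifting property, for modules of arbitrary types.\<close>

definition projective ::
  "('a::ring_1 \<Rightarrow> 'm::ab_group_add \<Rightarrow> 'm) \<Rightarrow> 'm set \<Rightarrow> bool" where
  "projective sc P \<longleftrightarrow>
     (\<exists>(X :: 'm set) i p.
        module_hom_on sc P free_scale (combs X) i \<and>
        module_hom_on free_scale (combs X) sc P p \<and>
        (\<forall>x\<in>P. p (i x) = x))"


section \<open>Modules over the group ring\<close>

text \<open>The group \<open>G\<close> is a type of class \<open>group_add\<close>, whose operation is written additively but is not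
  assumed to be commutative. The type \<open>'g \<Rightarrow>\<^sub>0 'r\<close> of finitely supported functions carries the
  convolution product, so it is the group ring \<open>RG\<close>; the element \<open>r g\<close> of \<open>RG\<close> is
  \<open>Poly_Mapping.single g r\<close>.\<close>

definition r_scale ::
  "(('g::group_add \<Rightarrow>\<^sub>0 'r::ring_1) \<Rightarrow> 'm \<Rightarrow> 'm) \<Rightarrow> 'r \<Rightarrow> 'm \<Rightarrow> 'm" where
  "r_scale sc r = sc (Poly_Mapping.single 0 r)"

definition g_act ::
  "(('g::group_add \<Rightarrow>\<^sub>0 'r::ring_1) \<Rightarrow> 'm \<Rightarrow> 'm) \<Rightarrow> 'g \<Rightarrow> 'm \<Rightarrow> 'm" where
  "g_act sc g = sc (Poly_Mapping.single g 1)"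

definition trivial_scale :: "('g::group_add \<Rightarrow>\<^sub>0 'r::ring_1) \<Rightarrow> 'r \<Rightarrow> 'r" where
  "trivial_scale a r = (\<Sum>g\<in>Poly_Mapping.keys a. Poly_Mapping.lookup a g) * r"

text \<open>\<open>M\<close> is the permutation module \<open>R[S]\<close>, where \<open>S \<subseteq> M\<close> is the standard \<open>R\<close>-basis, and the
  stabilizers are finite. The group permutes \<open>S\<close>, and since \<open>M\<close> is an \<open>RG\<close>-module
  the action on \<open>M\<close> is the \<open>R\<close>-linear extension of that on \<open>S\<close>.\<close>

definition proper_permutation_module ::
  "(('g::group_add \<Rightarrow>\<^sub>0 'r::ring_1) \<Rightarrow> 'm::ab_group_add \<Rightarrow> 'm) \<Rightarrow> 'm set \<Rightarrow> 'm set \<Rightarrow> bool" where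
  "proper_permutation_module sc M S \<longleftrightarrow>
     module_basis (r_scale sc) M S \<and>
     (\<forall>g. \<forall>s\<in>S. g_act sc g s \<in> S) \<and>
     (\<forall>s\<in>S. finite {g. g_act sc g s = s})"


section \<open>Norms\<close>

definition l1_norm ::
  "('r \<Rightarrow> real) \<Rightarrow> ('r::ring_1 \<Rightarrow> 'm::ab_group_add \<Rightarrow> 'm) \<Rightarrow> 'm set \<Rightarrow> 'm \<Rightarrow> real" where
  "l1_norm nrm sc B m =
     (\<Sum>x\<in>Poly_Mapping.keys (coords sc B m). nrm (Poly_Mapping.lookup (coords sc B m) x))"

text \<open>A free \<open>RG\<close>-module with \<open>RG\<close>-basis \<open>L\<close> has the \<open>R\<close>-basis \<open>{g x | g \<in> G, x \<in> L}\<close>, which is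
  indexed bijectively by \<open>L \<times> G\<close>.\<close>

definition free_l1_norm ::
  "('r \<Rightarrow> real) \<Rightarrow> (('g::group_add \<Rightarrow>\<^sub>0 'r::ring_1) \<Rightarrow> 'm::ab_group_add \<Rightarrow> 'm) \<Rightarrow> 'm set \<Rightarrow> 'm \<Rightarrow> real"
  where
  "free_l1_norm nrm sc L = l1_norm nrm (r_scale sc) {g_act sc g x | g x. x \<in> L}"

definition filling_norm :: "('f \<Rightarrow> real) \<Rightarrow> 'f set \<Rightarrow> ('f \<Rightarrow> 'm) \<Rightarrow> 'm \<Rightarrow> real" where
  "filling_norm nF F \<pi> m = (INF x\<in>{x \<in> F. \<pi> x = m}. nF x)"


section \<open>Resolutions and isoperimetric functions\<close>

text \<open>\<open>d (Suc k) : C (Suc k) \<rightarrow> C k\<close> is the boundary map, \<open>e : C 0 \<rightarrow> R\<close> is the augmentation, and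
  \<open>d 0\<close> is not used.\<close>

definition projective_resolution ::
  "(('g::group_add \<Rightarrow>\<^sub>0 'r::ring_1) \<Rightarrow> 'm::ab_group_add \<Rightarrow> 'm) \<Rightarrow> (nat \<Rightarrow> 'm set) \<Rightarrow>
   (nat \<Rightarrow> 'm \<Rightarrow> 'm) \<Rightarrow> ('m \<Rightarrow> 'r) \<Rightarrow> bool" where
  "projective_resolution sc C d e \<longleftrightarrow>
     left_module sc \<and>
     (\<forall>k. submodule sc (C k) \<and> projective sc (C k)) \<and>
     (\<forall>k. module_hom_on sc (C (Suc k)) sc (C k) (d (Suc k))) \<and>
     module_hom_on sc (C 0) trivial_scale UNIV e \<and>
     e ` C 0 = UNIV \<and>
     {x \<in> C 0. e x = 0} = d (Suc 0) ` C (Suc 0) \<and>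
     (\<forall>k. {x \<in> C (Suc k). d (Suc k) x = 0} = d (Suc (Suc k)) ` C (Suc (Suc k)))"

text \<open>\<open>L\<close> and \<open>L'\<close> are the fixed \<open>RG\<close>-bases of \<open>C n\<close> and \<open>C (Suc n)\<close>.\<close>

definition admissible_resolution ::
  "nat \<Rightarrow> (('g::group_add \<Rightarrow>\<^sub>0 'r::ring_1) \<Rightarrow> 'm::ab_group_add \<Rightarrow> 'm) \<Rightarrow> (nat \<Rightarrow> 'm set) \<Rightarrow>
   (nat \<Rightarrow> 'm \<Rightarrow> 'm) \<Rightarrow> ('m \<Rightarrow> 'r) \<Rightarrow> 'm set \<Rightarrow> 'm set \<Rightarrow> bool" where
  "admissible_resolution n sc C d e L L' \<longleftrightarrow>
     projective_resolution sc C d e \<and>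
     finite L \<and> module_basis sc (C n) L \<and>
     finite L' \<and> module_basis sc (C (Suc n)) L'"

definition isoperimetric ::
  "('r \<Rightarrow> real) \<Rightarrow> nat \<Rightarrow> (('g::group_add \<Rightarrow>\<^sub>0 'r::ring_1) \<Rightarrow> 'm::ab_group_add \<Rightarrow> 'm) \<Rightarrow>
   (nat \<Rightarrow> 'm set) \<Rightarrow> (nat \<Rightarrow> 'm \<Rightarrow> 'm) \<Rightarrow> 'm set \<Rightarrow> 'm set \<Rightarrow> real \<Rightarrow> ennreal" where
  "isoperimetric nrm n sc C d L L' l =
     (SUP b\<in>{b \<in> d (Suc n) ` C (Suc n). free_l1_norm nrm sc L b \<le> l}.
        ennreal (filling_norm (free_l1_norm nrm sc L') (C (Suc n)) (d (Suc n)) b))"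

definition finite_valued :: "(real \<Rightarrow> ennreal) \<Rightarrow> bool" where
  "finite_valued f \<longleftrightarrow> (\<forall>l\<ge>0. f l < \<infinity>)"

text \<open>The comparison is made in \<open>ereal\<close>, because \<open>ennreal\<close> truncates negative reals to 0.\<close>

definition linearly_bounded :: "(real \<Rightarrow> ennreal) \<Rightarrow> bool" where
  "linearly_bounded f \<longleftrightarrow> (\<exists>C::real. \<forall>l\<ge>0. enn2ereal (f l) \<le> ereal (C * l + C))"

text \<open>\<open>dim_admissible TYPE('m) TYPE('g) TYPE('r) m\<close>: the group \<open>'g\<close> is \<open>m\<close>-dimensional admissible over
  \<open>'r\<close>, witnessed by a resolution whose ambient module has type \<open>'m\<close>. HOL cannot quantify over
  \<open>'m\<close> inside the definition. In a hypothesis of a theorem in which \<open>'m\<close> occurs nowhere else, the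
  predicate means that such a resolution exists over some type. The standard norms of the two
  permutation modules are determined by the bases \<open>S\<close> and \<open>S'\<close>.\<close>

definition dim_admissible ::
  "'m::ab_group_add itself \<Rightarrow> 'g::group_add itself \<Rightarrow> 'r::ring_1 itself \<Rightarrow> nat \<Rightarrow> bool" where
  "dim_admissible _ _ _ m \<longleftrightarrow>
     (\<exists>n (sc :: ('g \<Rightarrow>\<^sub>0 'r) \<Rightarrow> 'm \<Rightarrow> 'm) C d e S S'. m = Suc n \<and>
        projective_resolution sc C d e \<and>
        fin_gen sc (C n) \<and> proper_permutation_module sc (C n) S \<and>
        fin_gen sc (C (Suc n)) \<and> proper_permutation_module sc (C (Suc n)) S' \<and>
        inj_on (d (Suc n)) (C (Suc n)))"


section \<open>Projective modules and the lifting property\<close>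

lemma lookup_free_scale [simp]:
  "Poly_Mapping.lookup (free_scale a c) x = a * Poly_Mapping.lookup c x"
  by (simp add: free_scale_def Poly_Mapping.map.rep_eq when_def)

lemma left_module_free: "left_module free_scale"
  by standard (auto intro!: poly_mapping_eqI simp: lookup_add algebra_simps)

lemma submodule_combs: "submodule free_scale (combs X)"
  unfolding submodule_def
proof (intro conjI ballI allI)
  show "0 \<in> combs X" by (simp add: combs_def)
  show "c + d \<in> combs X" if "c \<in> combs X" "d \<in> combs X" for c d
    using that Poly_Mapping.keys_add[of c d] unfolding combs_def by fast
  show "free_scale a c \<in> combs X" if "c \<in> combs X" for a c
    using that unfolding combs_def by (metis (no_types, lifting) in_keys_iff lookup_free_scale mem_Collect_eq
        mult_zero_right subset_iff)
qed

context left_module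
begin

lemma sc_zero_left [simp]: "sc 0 x = 0"
  using sc_add_left[of 0 0 x] by simp

lemma sc_zero_right [simp]: "sc a 0 = 0"
  using sc_add_right[of a 0 0] by simp

lemma sc_sum_right: "sc a (sum f A) = (\<Sum>x\<in>A. sc a (f x))"
  by (induction A rule: infinite_finite_induct) (auto simp: sc_add_right)

end

lemma submodule_sum:
  assumes "submodule sc M" "\<And>x. x \<in> A \<Longrightarrow> f x \<in> M"
  shows "sum f A \<in> M"
  using assms(2)
  by (induction A rule: infinite_finite_induct) (use assms(1) in \<open>auto simp: submodule_def\<close>)

definition free_extend ::
  "('a::ring_1 \<Rightarrow> 'm::ab_group_add \<Rightarrow> 'm) \<Rightarrow> ('x \<Rightarrow> 'm) \<Rightarrow> ('x \<Rightarrow>\<^sub>0 'a) \<Rightarrow> 'm" where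
  "free_extend sc h c = (\<Sum>x\<in>Poly_Mapping.keys c. sc (Poly_Mapping.lookup c x) (h x))"

lemma free_extend_supset:
  assumes "left_module sc" "finite K" "Poly_Mapping.keys c \<subseteq> K"
  shows "free_extend sc h c = (\<Sum>x\<in>K. sc (Poly_Mapping.lookup c x) (h x))"
  unfolding free_extend_def
  by (rule sum.mono_neutral_left)
     (use assms in \<open>auto simp: in_keys_iff left_module.sc_zero_left\<close>)

lemma free_extend_hom:
  fixes sc :: "'a::ring_1 \<Rightarrow> 'm::ab_group_add \<Rightarrow> 'm"
  assumes lm: "left_module sc" and "submodule sc M" "h ` X \<subseteq> M"
  shows "module_hom_on free_scale (combs X) sc M (free_extend sc h)"
  unfolding module_hom_on_def
proof (intro conjI ballI allI)
  show "free_extend sc h ` combs X \<subseteq> M"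
    using assms(2,3) unfolding free_extend_def combs_def
    by (auto intro!: submodule_sum[OF assms(2)] simp: submodule_def subset_iff)
next
  fix c d :: "'b \<Rightarrow>\<^sub>0 'a"
  let ?K = "Poly_Mapping.keys c \<union> Poly_Mapping.keys d"
  have "free_extend sc h (c + d) = (\<Sum>x\<in>?K. sc (Poly_Mapping.lookup (c + d) x) (h x))"
    by (rule free_extend_supset[OF lm]) (auto dest: subsetD[OF Poly_Mapping.keys_add])
  also have "\<dots> = (\<Sum>x\<in>?K. sc (Poly_Mapping.lookup c x) (h x)) +
      (\<Sum>x\<in>?K. sc (Poly_Mapping.lookup d x) (h x))"
    by (simp add: lookup_add left_module.sc_add_left[OF lm] sum.distrib)
  also have "\<dots> = free_extend sc h c + free_extend sc h d"
    by (simp add: free_extend_supset[OF lm, of ?K])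
  finally show "free_extend sc h (c + d) = free_extend sc h c + free_extend sc h d" .
next
  fix a and c :: "'b \<Rightarrow>\<^sub>0 'a"
  have "Poly_Mapping.keys (free_scale a c) \<subseteq> Poly_Mapping.keys c"
    by (metis in_keys_iff lookup_free_scale mult_zero_right subsetI)
  then have "free_extend sc h (free_scale a c) =
      (\<Sum>x\<in>Poly_Mapping.keys c. sc (Poly_Mapping.lookup (free_scale a c) x) (h x))"
    by (intro free_extend_supset[OF lm]) auto
  then show "free_extend sc h (free_scale a c) = sc a (free_extend sc h c)"
    by (simp add: free_extend_def left_module.sc_sum_right[OF lm] left_module.sc_sc[OF lm])
qed

lemma free_extend_single:
  assumes "left_module sc"
  shows "free_extend sc h (Poly_Mapping.single x 1) = h x"
  using free_extend_supset[OF assms, of "{x}" "Poly_Mapping.single x 1"]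
  by (simp add: left_module.sc_one[OF assms])

lemma hom_free_eq:
  fixes sc :: "'a::ring_1 \<Rightarrow> 'm::ab_group_add \<Rightarrow> 'm"
  assumes lm: "left_module sc" and hom: "module_hom_on free_scale (combs X) sc M p"
    and c: "c \<in> combs X"
  shows "p c = free_extend sc (\<lambda>x. p (Poly_Mapping.single x 1)) c"
proof -
  have p0: "p 0 = 0"
  proof -
    have "(0 :: 'b \<Rightarrow>\<^sub>0 'a) \<in> combs X" by (simp add: combs_def)
    then have "p (0 + 0) = p 0 + p 0" using hom unfolding module_hom_on_def by blast
    then show ?thesis by simp
  qed
  have s: "Poly_Mapping.single x (1::'a) \<in> combs X" if "x \<in> X" for x
    using that by (simp add: combs_def)
  have fs: "free_scale a (Poly_Mapping.single x (1::'a)) \<in> combs X" if "x \<in> X" for a x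
    using submodule_combs[of X] s[OF that] unfolding submodule_def by blast
  have sum: "p (\<Sum>x\<in>K. free_scale (Poly_Mapping.lookup c x) (Poly_Mapping.single x 1)) =
      (\<Sum>x\<in>K. sc (Poly_Mapping.lookup c x) (p (Poly_Mapping.single x 1)))"
    if "finite K" "K \<subseteq> X" for K
    using that
  proof (induction K)
    case (insert x K)
    have "free_scale (Poly_Mapping.lookup c x) (Poly_Mapping.single x 1) \<in> combs X"
      using fs insert by blast
    moreover have "(\<Sum>x\<in>K. free_scale (Poly_Mapping.lookup c x) (Poly_Mapping.single x 1)) \<in> combs X"
      by (rule submodule_sum[OF submodule_combs]) (use fs insert in blast)
    ultimately show ?case
      using insert hom s by (simp add: module_hom_on_def)
  qed (use p0 in simp)
  have "c = (\<Sum>x\<in>Poly_Mapping.keys c. free_scale (Poly_Mapping.lookup c x) (Poly_Mapping.single x 1))"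
    by (rule poly_mapping_eqI)
       (simp add: lookup_sum lookup_single when_def in_keys_iff if_distrib[of "\<lambda>z. _ * z"] cong: if_cong)
  then show ?thesis
    using sum[of "Poly_Mapping.keys c"] c by (simp add: free_extend_def combs_def)
qed

lemma projective_lift:
  fixes sc :: "'a::ring_1 \<Rightarrow> 'm::ab_group_add \<Rightarrow> 'm"
    and scA :: "'a \<Rightarrow> 'x::ab_group_add \<Rightarrow> 'x"
    and scB :: "'a \<Rightarrow> 'y::ab_group_add \<Rightarrow> 'y"
  assumes P: "projective sc P"
    and A: "left_module scA" "submodule scA A" and B: "left_module scB"
    and q: "module_hom_on scA A scB B q" "q ` A = B"
    and f: "module_hom_on sc P scB B f"
  obtains f' where "module_hom_on sc P scA A f'" "\<And>x. x \<in> P \<Longrightarrow> q (f' x) = f x"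
proof -
  obtain X :: "'m set" and i p where i: "module_hom_on sc P free_scale (combs X) i"
    and p: "module_hom_on free_scale (combs X) sc P p" and pi: "\<And>x. x \<in> P \<Longrightarrow> p (i x) = x"
    using P unfolding projective_def by blast
  define h where "h x = (SOME a. a \<in> A \<and> q a = f (p (Poly_Mapping.single x 1)))" for x
  have h: "h x \<in> A \<and> q (h x) = f (p (Poly_Mapping.single x 1))" if "x \<in> X" for x
  proof -
    have "Poly_Mapping.single x (1::'a) \<in> combs X" using that by (simp add: combs_def)
    then have "f (p (Poly_Mapping.single x 1)) \<in> q ` A"
      using p f q(2) unfolding module_hom_on_def by (simp add: image_subset_iff)
    then have "\<exists>a. a \<in> A \<and> q a = f (p (Poly_Mapping.single x 1))" by fastforce
    then show ?thesis unfolding h_def by (rule someI_ex)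
  qed
  have e: "module_hom_on free_scale (combs X) scA A (free_extend scA h)"
    using free_extend_hom[OF A, of h X] h by blast
  have fp: "module_hom_on free_scale (combs X) scB B (f \<circ> p)"
    using p f by (auto simp: module_hom_on_def image_subset_iff)
  have qe: "module_hom_on free_scale (combs X) scB B (q \<circ> free_extend scA h)"
    using e q(1) by (auto simp: module_hom_on_def image_subset_iff)
  have eq: "q (free_extend scA h c) = f (p c)" if "c \<in> combs X" for c
  proof -
    have "(q \<circ> free_extend scA h) c =
        free_extend scB (\<lambda>x. (q \<circ> free_extend scA h) (Poly_Mapping.single x 1)) c"
      by (rule hom_free_eq[OF B qe that])
    also have "\<dots> = free_extend scB (\<lambda>x. (f \<circ> p) (Poly_Mapping.single x 1)) c"
      unfolding free_extend_def
    proof (intro sum.cong refl)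
      fix x assume "x \<in> Poly_Mapping.keys c"
      then have "x \<in> X" using that by (auto simp: combs_def)
      then show "scB (Poly_Mapping.lookup c x)
          ((q \<circ> (\<lambda>c. \<Sum>x\<in>Poly_Mapping.keys c. scA (Poly_Mapping.lookup c x) (h x))) (Poly_Mapping.single x 1)) =
        scB (Poly_Mapping.lookup c x) ((f \<circ> p) (Poly_Mapping.single x 1))"
        using h free_extend_single[OF A(1), of h x] by (simp add: free_extend_def)
    qed
    also have "\<dots> = (f \<circ> p) c" by (rule hom_free_eq[OF B fp that, symmetric])
    finally show ?thesis by simp
  qed
  show ?thesis
  proof
    show "module_hom_on sc P scA A (free_extend scA h \<circ> i)"
      using i e by (auto simp: module_hom_on_def image_subset_iff)
    show "q ((free_extend scA h \<circ> i) x) = f x" if "x \<in> P" for x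
      using eq[of "i x"] pi[OF that] i that by (auto simp: module_hom_on_def)
  qed
qed

text \<open>Conversely, lifting the identity along the canonical surjection from the free module on \<open>P\<close> is
  enough.\<close>

lemma projective_if_lift:
  fixes sc :: "'a::ring_1 \<Rightarrow> 'm::ab_group_add \<Rightarrow> 'm"
  assumes sc: "left_module sc" and P: "submodule sc P"
    and lift: "\<And>(q :: ('m \<Rightarrow>\<^sub>0 'a) \<Rightarrow> 'm).
        module_hom_on free_scale (combs P) sc P q \<Longrightarrow> q ` combs P = P \<Longrightarrow>
        \<exists>i. module_hom_on sc P free_scale (combs P) i \<and> (\<forall>x\<in>P. q (i x) = x)"
  shows "projective sc P"
proof -
  let ?q = "free_extend sc (\<lambda>x. x)"
  have q: "module_hom_on free_scale (combs P) sc P ?q"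
    by (rule free_extend_hom[OF sc P]) auto
  have "P \<subseteq> ?q ` combs P"
  proof
    fix x assume "x \<in> P"
    then have "Poly_Mapping.single x (1::'a) \<in> combs P" by (simp add: combs_def)
    then show "x \<in> ?q ` combs P"
      by (rule rev_image_eqI) (simp add: free_extend_single[OF sc])
  qed
  with q have "?q ` combs P = P" by (auto simp: module_hom_on_def)
  with lift[OF q] q show ?thesis unfolding projective_def by blast
qed

end

(* Rational scalars scale the l1-norms exactly and commute with the boundary map, so the filling norm
   is homogeneous under them. An l-ball of the boundaries is therefore contained in N times the
   unit ball for every integer N \<ge> l, N \<ge> 1, and the isoperimetric function satisfies
   f(l) \<le> N f(1). *)

theory Submission
  imports Defs
begin

section \<open>Linear combinations and coordinates\<close>

lemma lincomb_eq_free_extend: "lincomb sc = free_extend sc (\<lambda>x. x)"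
  by (rule ext) (simp add: lincomb_def free_extend_def)

lemma lincomb_hom:
  assumes "left_module sc" "submodule sc M" "B \<subseteq> M"
  shows "module_hom_on free_scale (combs B) sc M (lincomb sc)"
  unfolding lincomb_eq_free_extend by (rule free_extend_hom) (use assms in auto)

text \<open>Serves twice: for the R-span of the translates of a basis, and for the boundaries, which
  must stay boundaries after multiplication by 1/N.\<close>

lemma submodule_hom_image:
  assumes f: "module_hom_on sc M sc' N f" and M: "submodule sc M"
  shows "submodule sc' (f ` M)"
proof -
  have "f 0 = 0"
  proof -
    have "f (0 + 0) = f 0 + f 0"
      using f M unfolding module_hom_on_def submodule_def by blast
    then show ?thesis by simp
  qed
  moreover have "0 \<in> M" using M by (simp add: submodule_def)
  ultimately have "0 \<in> f ` M" by (metis imageI)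
  moreover have "f x + f y \<in> f ` M" if "x \<in> M" "y \<in> M" for x y
  proof -
    have "f x + f y = f (x + y)" using f that by (simp add: module_hom_on_def)
    then show ?thesis using M that by (auto simp: submodule_def)
  qed
  moreover have "sc' a (f x) \<in> f ` M" if "x \<in> M" for a x
  proof -
    have "sc' a (f x) = f (sc a x)" using f that by (simp add: module_hom_on_def)
    then show ?thesis using M that by (auto simp: submodule_def)
  qed
  ultimately show ?thesis unfolding submodule_def by blast
qed

lemma module_hom_on_inj:
  assumes f: "module_hom_on sc M sc' N f" and lm: "left_module sc" and M: "submodule sc M"
    and ker: "\<And>x. x \<in> M \<Longrightarrow> f x = 0 \<Longrightarrow> x = 0"
  shows "inj_on f M"
proof (rule inj_onI)
  fix x y assume xy: "x \<in> M" "y \<in> M" "f x = f y"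
  \<comment> \<open>Submodules are closed under sums and scalars only, so \<open>- y\<close> enters
    as a scalar multiple. The value of \<open>f\<close> at the difference is then found by adding
    \<open>f y\<close> back and cancelling.\<close>
  have neg: "sc (- 1) y = - y"
    using left_module.sc_add_left[OF lm, of "- 1" 1 y]
    by (simp add: left_module.sc_zero_left[OF lm] left_module.sc_one[OF lm] eq_neg_iff_add_eq_0)
  have my: "- y \<in> M" using M xy(2) neg by (metis submodule_def)
  have diff: "x - y \<in> M" using M xy(1) my by (metis submodule_def uminus_add_conv_diff add.commute)
  have "f (x - y) + f y = f (x - y + y)"
    using f diff xy(2) unfolding module_hom_on_def by metis
  then have "f (x - y) = 0" using xy(3) by simp
  with ker[OF diff] show "x = y" by simp
qed

text \<open>\<open>free_scale a\<close> of the coordinates of \<open>m\<close> is a preimage of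
  \<open>sc a m\<close> in \<open>combs B\<close>, because \<open>lincomb\<close> is linear;
  injectivity of \<open>lincomb\<close> makes it the only one.\<close>

lemma coords_scale:
  assumes lm: "left_module sc" and M: "submodule sc M" and B: "module_basis sc M B"
    and m: "m \<in> M"
  shows "coords sc B (sc a m) = free_scale a (coords sc B m)"
proof -
  have bij: "bij_betw (lincomb sc) (combs B) M" and BM: "B \<subseteq> M"
    using B by (auto simp: module_basis_def)
  then have inj: "inj_on (lincomb sc) (combs B)" and im: "lincomb sc ` combs B = M"
    by (auto simp: bij_betw_def)
  from m im obtain c where c: "c \<in> combs B" "m = lincomb sc c" by blast
  have "lincomb sc (free_scale a c) = sc a m"
    using lincomb_hom[OF lm M BM] c by (simp add: module_hom_on_def)
  moreover have "free_scale a c \<in> combs B"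
    using submodule_combs[of B] c(1) by (auto simp: submodule_def)
  ultimately show ?thesis
    unfolding coords_def using the_inv_into_f_f[OF inj] c by metis
qed

lemma l1_norm_scale:
  assumes "left_module sc" "submodule sc M" "module_basis sc M B" "m \<in> M"
    and nrm: "\<And>s. nrm (a * s) = t * nrm s" and zero: "nrm 0 = 0"
  shows "l1_norm nrm sc B (sc a m) = t * l1_norm nrm sc B m"
proof -
  let ?c = "coords sc B m"
  have "l1_norm nrm sc B (sc a m) =
      (\<Sum>x\<in>Poly_Mapping.keys (free_scale a ?c). nrm (Poly_Mapping.lookup (free_scale a ?c) x))"
    by (simp only: l1_norm_def coords_scale[OF assms(1-4)])
  \<comment> \<open>Multiplication by \<open>a\<close> may kill coefficients and shrink the support;
    the terms added back are \<open>nrm 0 = 0\<close>.\<close>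
  also have "\<dots> = (\<Sum>x\<in>Poly_Mapping.keys ?c. nrm (Poly_Mapping.lookup (free_scale a ?c) x))"
    by (rule sum.mono_neutral_left) (auto simp: in_keys_iff zero simp del: lookup_not_eq_zero_eq_in_keys)
  also have "\<dots> = t * l1_norm nrm sc B m"
    by (simp add: l1_norm_def nrm sum_distrib_left)
  finally show ?thesis .
qed


section \<open>The basis of a free RG-module over R\<close>

text \<open>Restriction of scalars along the embedding of R into RG at the neutral element of the
  group, which is written \<open>0\<close>.\<close>

lemma left_module_r_scale:
  assumes "left_module sc"
  shows "left_module (r_scale sc)"
proof -
  interpret left_module sc by fact
  show ?thesis
    by standard
      (auto simp: r_scale_def sc_add_right sc_add_left sc_sc single_add mult_single sc_one)
qed

lemma submodule_r_scale: "submodule sc M \<Longrightarrow> submodule (r_scale sc) M"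
  by (simp add: submodule_def r_scale_def)

lemma r_scale_g_act:
  assumes "left_module sc"
  shows "r_scale sc r (g_act sc g x) = sc (Poly_Mapping.single g r) x"
  by (simp add: r_scale_def g_act_def left_module.sc_sc[OF assms] mult_single)

lemma sum_single_keys:
  "a = (\<Sum>g\<in>Poly_Mapping.keys a. Poly_Mapping.single g (Poly_Mapping.lookup a g))"
  by (rule poly_mapping_eqI) (simp add: lookup_sum lookup_single when_def in_keys_iff)

lemma left_module_sc_sum_left:
  assumes "left_module sc"
  shows "sc (sum f A) x = (\<Sum>y\<in>A. sc (f y) x)"
  by (induction A rule: infinite_finite_induct)
    (auto simp: left_module.sc_zero_left[OF assms] left_module.sc_add_left[OF assms])

text \<open>Needed because \<open>coords\<close>, and with it \<open>free_l1_norm\<close>, inverts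
  \<open>lincomb\<close> only over an actual R-basis. Each coefficient in RG is a unique sum of
  monomials r g, so an RG-combination of \<open>L\<close> is the same as an R-combination of
  translates.\<close>

lemma module_basis_r_scale:
  fixes sc :: "('g::group_add \<Rightarrow>\<^sub>0 'r::ring_1) \<Rightarrow> 'm::ab_group_add \<Rightarrow> 'm"
  assumes lm: "left_module sc" and M: "submodule sc M" and L: "module_basis sc M L"
  shows "module_basis (r_scale sc) M {g_act sc g x | g x. x \<in> L}"
proof -
  define B where "B = {g_act sc g x | g x. x \<in> L}"
  have LM: "L \<subseteq> M" and inj: "inj_on (lincomb sc) (combs L)" and im: "lincomb sc ` combs L = M"
    using L by (auto simp: module_basis_def bij_betw_def)
  have BM: "B \<subseteq> M" using LM M by (auto simp: B_def g_act_def submodule_def)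
  note lmr = left_module_r_scale[OF lm] and Mr = submodule_r_scale[OF M]
  note hom = lincomb_hom[OF lmr Mr BM]
  note homL = lincomb_hom[OF lm M LM]

  \<comment> \<open>A choice of group part \<open>u y\<close> and basis part \<open>v y\<close> for
    every translate \<open>y\<close> turns R-combinations of \<open>B\<close> into RG-combinations
    of \<open>L\<close>.\<close>
  obtain u v where uv: "\<And>y. y \<in> B \<Longrightarrow> v y \<in> L \<and> y = g_act sc (u y) (v y)"
    proof -
    have "\<forall>y\<in>B. \<exists>w. snd w \<in> L \<and> y = g_act sc (fst w) (snd w)" by (fastforce simp: B_def)
    then obtain w where "\<forall>y\<in>B. snd (w y) \<in> L \<and> y = g_act sc (fst (w y)) (snd (w y))" by metis
    then show thesis by (intro that[of "\<lambda>y. snd (w y)" "\<lambda>y. fst (w y)"]) auto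
  qed
  have "inj_on (lincomb (r_scale sc)) (combs B)"
  proof (rule module_hom_on_inj[OF hom left_module_free submodule_combs])
    fix c :: "'m \<Rightarrow>\<^sub>0 'r" assume c: "c \<in> combs B" and c0: "lincomb (r_scale sc) c = 0"
    then have cB: "Poly_Mapping.keys c \<subseteq> B" by (simp add: combs_def)
    \<comment> \<open>\<open>s y\<close> is the one-term RG-combination with coefficient
      \<open>c\<close>(y) \<open>u y\<close> at \<open>v y\<close>. Their sum \<open>p\<close>
      represents the same element as \<open>c\<close>, so independence of \<open>L\<close> over RG
      forces \<open>p = 0\<close>.\<close>
    define s where "s y = Poly_Mapping.single (v y) (Poly_Mapping.single (u y) (Poly_Mapping.lookup c y))" for y
    define p where "p = (\<Sum>y\<in>Poly_Mapping.keys c. s y)"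
    have sL: "s y \<in> combs L" if "y \<in> Poly_Mapping.keys c" for y
      using uv that cB by (auto simp: s_def combs_def)
    have lins: "lincomb sc (s y) = r_scale sc (Poly_Mapping.lookup c y) y"
      if "y \<in> Poly_Mapping.keys c" for y
    proof -
      have "lincomb sc (s y) = sc (Poly_Mapping.single (u y) (Poly_Mapping.lookup c y)) (v y)"
        by (simp add: lincomb_def s_def left_module.sc_zero_left[OF lm])
      then show ?thesis
        using uv[of y] that cB r_scale_g_act[OF lm, of "Poly_Mapping.lookup c y" "u y" "v y"] by auto
    qed
    have l0: "lincomb sc 0 = 0" by (simp add: lincomb_def)
    \<comment> \<open>Additivity of \<open>lincomb sc\<close> is available on \<open>combs L\<close>
      only, so the induction carries membership of the partial sums along.\<close>
    have "lincomb sc (\<Sum>y\<in>K. s y) = (\<Sum>y\<in>K. lincomb sc (s y)) \<and> (\<Sum>y\<in>K. s y) \<in> combs L"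
      if "finite K" "K \<subseteq> Poly_Mapping.keys c" for K
      using that
    proof (induction K)
      case (insert y K)
      then show ?case
        using homL sL[of y] submodule_combs[of L] by (auto simp: module_hom_on_def submodule_def)
    qed (use submodule_combs[of L] in \<open>auto simp: submodule_def l0\<close>)
    from this[of "Poly_Mapping.keys c"] have "lincomb sc p = lincomb (r_scale sc) c" and pL: "p \<in> combs L"
      by (auto simp: p_def lins lincomb_def[of "r_scale sc"])
    with c0 l0 have "lincomb sc p = lincomb sc 0" by simp
    then have p0: "p = 0"
      using inj pL submodule_combs[of L] by (auto simp: inj_on_def submodule_def)
    show "c = 0"
    proof (rule poly_mapping_eqI)
      fix z
      show "Poly_Mapping.lookup c z = Poly_Mapping.lookup 0 z"
      proof (cases "z \<in> Poly_Mapping.keys c")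
        case True
        \<comment> \<open>The pair \<open>(u y, v y)\<close> determines \<open>y\<close>, so only \<open>y = z\<close> contributes.\<close>
        have "Poly_Mapping.lookup (Poly_Mapping.lookup (s y) (v z)) (u z) =
            (if y = z then Poly_Mapping.lookup c z else 0)" if "y \<in> Poly_Mapping.keys c" for y
        proof -
          have "y = z" if "u y = u z" "v y = v z"
            using uv[of y] uv[of z] True \<open>y \<in> Poly_Mapping.keys c\<close> cB that by (metis subsetD)
          then show ?thesis by (auto simp: s_def lookup_single when_def)
        qed
        then have "Poly_Mapping.lookup (Poly_Mapping.lookup p (v z)) (u z) = Poly_Mapping.lookup c z"
          using True by (simp add: p_def lookup_sum)
        then show ?thesis by (simp add: p0)
      qed (simp add: in_keys_iff)
    qed
  qed
  moreover have "lincomb (r_scale sc) ` combs B = M"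
  proof
    show "lincomb (r_scale sc) ` combs B \<subseteq> M" using hom by (simp add: module_hom_on_def)
    \<comment> \<open>The span is closed under sums and R-scalars, so it suffices to place the
      elements r g x in it, for \<open>x\<close> in \<open>L\<close>.\<close>
    have sub: "submodule (r_scale sc) (lincomb (r_scale sc) ` combs B)"
      by (rule submodule_hom_image[OF hom submodule_combs])
    show "M \<subseteq> lincomb (r_scale sc) ` combs B"
    proof
      fix m assume "m \<in> M"
      with im obtain a where a: "a \<in> combs L" "m = lincomb sc a" by blast
      have gen: "y \<in> lincomb (r_scale sc) ` combs B" if "y \<in> B" for y
      proof -
        have "lincomb (r_scale sc) (Poly_Mapping.single y 1) = y"
          by (simp add: lincomb_eq_free_extend free_extend_single[OF lmr])
        moreover have "Poly_Mapping.single y (1::'r) \<in> combs B" using that by (simp add: combs_def)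
        ultimately show ?thesis by (metis imageI)
      qed
      have "sc (Poly_Mapping.lookup a x) x \<in> lincomb (r_scale sc) ` combs B" if "x \<in> L" for x
      proof -
        have "sc (Poly_Mapping.lookup a x) x =
            (\<Sum>g\<in>Poly_Mapping.keys (Poly_Mapping.lookup a x).
              r_scale sc (Poly_Mapping.lookup (Poly_Mapping.lookup a x) g) (g_act sc g x))"
          by (subst sum_single_keys[of "Poly_Mapping.lookup a x"])
            (simp only: left_module_sc_sum_left[OF lm] r_scale_g_act[OF lm])
        moreover have "r_scale sc r (g_act sc g x) \<in> lincomb (r_scale sc) ` combs B" for r g
        proof -
          have "g_act sc g x \<in> B" using that by (auto simp: B_def)
          from gen[OF this] sub show ?thesis unfolding submodule_def by blast
        qed
        ultimately show ?thesis by (simp only:) (rule submodule_sum[OF sub])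
      qed
      then show "m \<in> lincomb (r_scale sc) ` combs B"
        unfolding a(2) lincomb_def[of sc] using a(1)
        by (intro submodule_sum[OF sub]) (auto simp: combs_def[of L])
    qed
  qed
  ultimately show ?thesis using BM by (simp add: module_basis_def bij_betw_def flip: B_def)
qed


section \<open>Homogeneity of the filling norm\<close>

lemma free_l1_norm_scale:
  assumes "left_module sc" "submodule sc M" "module_basis sc M L" "m \<in> M"
    and "\<And>s. nrm (a * s) = t * nrm s" and "nrm 0 = 0"
  shows "free_l1_norm nrm sc L (r_scale sc a m) = t * free_l1_norm nrm sc L m"
  unfolding free_l1_norm_def
  by (rule l1_norm_scale[OF left_module_r_scale submodule_r_scale module_basis_r_scale])
    (use assms in auto)

lemma free_l1_norm_nonneg: "(\<And>a. 0 \<le> nrm a) \<Longrightarrow> 0 \<le> free_l1_norm nrm sc L m"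
  by (simp add: free_l1_norm_def l1_norm_def sum_nonneg)

text \<open>Multiplying a filling of \<open>b\<close> by \<open>a\<close> gives a filling of
  \<open>sc' a b\<close> whose norm is \<open>t\<close> times as large; then pass to the infimum
  over the fillings of \<open>b\<close>.\<close>

lemma filling_norm_scale_le:
  assumes hom: "module_hom_on sc F sc' N p" and F: "submodule sc F"
    and nonneg: "\<And>x. 0 \<le> nF x" and scale: "\<And>x. x \<in> F \<Longrightarrow> nF (sc a x) = t * nF x"
    and t: "0 < t" and b: "b \<in> p ` F"
  shows "filling_norm nF F p (sc' a b) \<le> t * filling_norm nF F p b"
proof -
  have "filling_norm nF F p (sc' a b) / t \<le> nF x" if x: "x \<in> F" "p x = b" for x
  proof -
    have "sc a x \<in> {y \<in> F. p y = sc' a b}"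
      using hom F x by (auto simp: module_hom_on_def submodule_def)
    \<comment> \<open>An infimum of reals is a lower bound only for sets bounded below; here 0 is a
      bound.\<close>
    then have "filling_norm nF F p (sc' a b) \<le> nF (sc a x)"
      unfolding filling_norm_def by (intro cINF_lower bdd_belowI2[of _ 0]) (auto simp: nonneg)
    then show ?thesis using scale[OF x(1)] t by (simp add: field_simps)
  qed
  \<comment> \<open>Since \<open>b\<close> lies in the image, the set of its fillings is nonempty,
    as the greatest lower bound property requires.\<close>
  then have "filling_norm nF F p (sc' a b) / t \<le> filling_norm nF F p b"
    unfolding filling_norm_def[of nF F p b] by (intro cINF_greatest) (use b in auto)
  then show ?thesis using t by (simp add: field_simps)
qed

text \<open>The factor is a natural number because exact homogeneity of \<open>nrm\<close> is given
  for rational scalars; rounding \<open>l\<close> up to \<open>N\<close> costs only a bounded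
  amount.\<close>

lemma isoperimetric_le_scaled:
  fixes nrm :: "'r::{division_ring, ring_char_0} \<Rightarrow> real"
  assumes nrm: "ring_norm nrm" "respects_rationals nrm"
    and adm: "admissible_resolution n sc C d e L L'"
    and c: "isoperimetric nrm n sc C d L L' 1 \<le> ennreal c" "0 \<le> c"
    and N: "l \<le> real N" "0 < N"
  shows "isoperimetric nrm n sc C d L L' l \<le> ennreal (real N * c)"
proof -
  have lm: "left_module sc" and sub: "\<And>k. submodule sc (C k)"
    and hom: "module_hom_on sc (C (Suc n)) sc (C n) (d (Suc n))"
    and L: "module_basis sc (C n) L" and L': "module_basis sc (C (Suc n)) L'"
    using adm by (auto simp: admissible_resolution_def projective_resolution_def)
  have nonneg: "0 \<le> nrm a" and zero: "nrm 0 = 0" for a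
    using nrm(1) by (auto simp: ring_norm_def)
  have rat: "nrm (of_int p / of_int q * r) = \<bar>real_of_int p / real_of_int q\<bar> * nrm r"
    if "q \<noteq> 0" for p q r
    using nrm(2) that by (auto simp: respects_rationals_def)
  define q :: 'r where "q = 1 / of_nat N"
  \<comment> \<open>In the instances of \<open>rat\<close> the denominator comes first: the scalar
    is N/1 here and 1/N in \<open>nq\<close>.\<close>
  have nN: "nrm (of_nat N * s) = real N * nrm s" for s
    using rat[of 1 "int N" s] by simp
  have nq: "nrm (q * s) = (1 / real N) * nrm s" for s
    using rat[of "int N" 1 s] N by (simp add: q_def)
  have Nq: "of_nat N * q = 1" using N by (simp add: q_def divide_inverse)
  let ?fill = "filling_norm (free_l1_norm nrm sc L') (C (Suc n)) (d (Suc n))"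
  have homr: "module_hom_on (r_scale sc) (C (Suc n)) (r_scale sc) (C n) (d (Suc n))"
    using hom by (simp add: module_hom_on_def r_scale_def)
  note lmr = left_module_r_scale[OF lm]
  show ?thesis
    unfolding isoperimetric_def
  proof (rule SUP_least)
    fix b assume "b \<in> {b \<in> d (Suc n) ` C (Suc n). free_l1_norm nrm sc L b \<le> l}"
    then have b: "b \<in> d (Suc n) ` C (Suc n)" "free_l1_norm nrm sc L b \<le> l" by auto
    then have bC: "b \<in> C n" using hom by (auto simp: module_hom_on_def)
    define b' where "b' = r_scale sc q b"
    have b': "b' \<in> d (Suc n) ` C (Suc n)"
      using submodule_hom_image[OF homr submodule_r_scale[OF sub]] b(1)
      by (auto simp: submodule_def b'_def)
    have bb': "r_scale sc (of_nat N) b' = b"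
      by (simp add: b'_def left_module.sc_sc[OF lmr] Nq left_module.sc_one[OF lmr])
    have "free_l1_norm nrm sc L b' = (1 / real N) * free_l1_norm nrm sc L b"
      unfolding b'_def by (rule free_l1_norm_scale[OF lm sub L bC nq zero])
    also have "\<dots> \<le> 1" using b(2) N by (simp add: field_simps)
    finally have "ennreal (?fill b') \<le> isoperimetric nrm n sc C d L L' 1"
      unfolding isoperimetric_def using b' by (intro SUP_upper) auto
    \<comment> \<open>\<open>ennreal\<close> truncates at 0, so reading off the real inequality
      relies on \<open>0 \<le> c\<close>.\<close>
    with c have "?fill b' \<le> c" by (meson ennreal_le_iff order_trans)
    moreover have "?fill b \<le> real N * ?fill b'"
      unfolding bb'[symmetric]
    proof (rule filling_norm_scale_le[OF homr submodule_r_scale[OF sub] _ _ _ b'])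
      show "0 \<le> free_l1_norm nrm sc L' x" for x by (rule free_l1_norm_nonneg[OF nonneg])
      show "free_l1_norm nrm sc L' (r_scale sc (of_nat N) x) = real N * free_l1_norm nrm sc L' x"
        if "x \<in> C (Suc n)" for x
        by (rule free_l1_norm_scale[OF lm sub L' that nN zero])
    qed (use N(2) in simp)
    ultimately have "?fill b \<le> real N * c"
      using N(2) by (meson mult_left_mono of_nat_0_le_iff order_trans)
    then show "ennreal (?fill b) \<le> ennreal (real N * c)" by (rule ennreal_leI)
  qed
qed

section \<open>The linear bound from the value at 1, and the converse\<close>

theorem theorem1p3:
  fixes nrm :: "'r::{division_ring, ring_char_0} \<Rightarrow> real"
    and n :: nat
    and sc :: "('g::group_add \<Rightarrow>\<^sub>0 'r) \<Rightarrow> 'm::ab_group_add \<Rightarrow> 'm"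
    and C :: "nat \<Rightarrow> 'm set"
    and d :: "nat \<Rightarrow> 'm \<Rightarrow> 'm"
    and e :: "'m \<Rightarrow> 'r"
    and L L' :: "'m set"
  assumes "ring_norm nrm"
    and "respects_rationals nrm"
    and "dim_admissible TYPE('d::ab_group_add) TYPE('g) TYPE('r) (n + 1)"
    and "admissible_resolution n sc C d e L L'"
  shows "finite_valued (isoperimetric nrm n sc C d L L') \<longleftrightarrow>
         linearly_bounded (isoperimetric nrm n sc C d L L')"
proof
  let ?f = "isoperimetric nrm n sc C d L L'"
  assume "finite_valued ?f"
  then have "?f 1 < \<infinity>" by (simp add: finite_valued_def)
  then obtain c where c: "0 \<le> c" "?f 1 = ennreal c"
    by (cases "?f 1") auto
  \<comment> \<open>From N \<le> l + 2 the bound is c l + 2 c; slope and intercept must share one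
    constant, hence 2 c for both.\<close>
  have "enn2ereal (?f l) \<le> ereal (2 * c * l + 2 * c)" if "0 \<le> l" for l
  proof -
    \<comment> \<open>The added 1 keeps \<open>N\<close> positive at \<open>l = 0\<close>.\<close>
    define N where "N = nat \<lceil>l\<rceil> + 1"
    have N: "l \<le> real N" "0 < N" "real N \<le> l + 2" using that unfolding N_def by linarith+
    have "real N * c \<le> (l + 2) * c" using N(3) c(1) by (rule mult_right_mono)
    also have "\<dots> \<le> 2 * c * l + 2 * c" using that c(1) by (simp add: algebra_simps)
    finally have Nc: "real N * c \<le> 2 * c * l + 2 * c" .
    have "?f l \<le> ennreal (real N * c)"
      using c by (intro isoperimetric_le_scaled[OF assms(1,2,4) _ _ N(1,2)]) auto
    also have "\<dots> \<le> ennreal (2 * c * l + 2 * c)" using Nc by (rule ennreal_leI)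
    \<comment> \<open>The bound is nonnegative, so its passage through \<open>ennreal\<close> to
      \<open>ereal\<close> loses nothing.\<close>
    finally show ?thesis
      using that c(1) by (simp add: less_eq_ennreal.rep_eq enn2ereal_ennreal del: ennreal_plus)
  qed
  then show "linearly_bounded ?f" unfolding linearly_bounded_def by blast
next
  let ?f = "isoperimetric nrm n sc C d L L'"
  assume "linearly_bounded ?f"
  then obtain K where K: "\<And>l. 0 \<le> l \<Longrightarrow> enn2ereal (?f l) \<le> ereal (K * l + K)"
    unfolding linearly_bounded_def by blast
  show "finite_valued ?f"
    unfolding finite_valued_def
  proof (intro allI impI)
    fix l :: real assume "0 \<le> l"
    \<comment> \<open>A bound by a real number in \<open>ereal\<close> excludes the value
      \<infinity>.\<close>
    from K[OF this] have "?f l \<noteq> \<infinity>" by auto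
    then show "?f l < \<infinity>" by (simp add: less_top)
  qed
qed

end
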